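(* Let $\alpha,\beta>0$, $\lambda,\sigma\in\mathbb{C}$ and $t>0$. (i) If $v_1<\alpha$, $v_2<\beta$ and $v=v_1+v_2$, then $$R_{\alpha,v_1}(\lambda,t)*R_{\beta,v_2}(\sigma,t)=\sum_{k=0}^\infty\sigma^kR_{\alpha,v-\beta(k+1)}(\lambda,t)=\sum_{j=0}^\infty\lambda^jR_{\beta,v-\alpha(j+1)}(\sigma,t).$$ (ii) If $w_1,w_2>-1$ and $w=w_1+w_2$, then $$P_{\alpha,w_1}(\lambda,t)*P_{\beta,w_2}(\sigma,t)=\sum_{k=0}^\infty\sigma^kP_{\alpha,w+\beta k+1}(\lambda,t)=\sum_{j=0}^\infty\lambda^jP_{\beta,w+\alpha j+1}(\sigma,t).$$
   Context: For $\alpha,\beta>0$ and $z\in\mathbb{C}$, the Mittag-Leffler function is $E_{\alpha,\beta}(z)=\sum_{n=0}^\infty \frac{z^n}{\Gamma(\alpha n+\beta)}$. For $\lambda\in\mathbb{C}$, $\alpha>0$, $t>0$: $P_{\alpha,w}(\lambda,t)=t^wE_{\alpha,w+1}(\lambda t^\alpha)=\sum_{n=0}^\infty\frac{\lambda^n t^{\alpha n+w}}{\Gamma(\alpha n+w+1)}$ for $w>-1$, and $R_{\alpha,v}(\lambda,t)=t^{\alpha-v-1}E_{\alpha,\alpha-v}(\lambda t^\alpha)=\sum_{n=0}^\infty\frac{\lambda^n t^{\alpha(n+1)-v-1}}{\Gamma(\alpha(n+1)-v)}$ for $v<\alpha$. The symbol $*$ denotes the causal convolution in the variable $t$: $(f*g)(t)=\int_0^t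 f(t-\tau)g(\tau)\,d\tau$. Convention: $0^0=1$. *)

theory Defs
  imports "HOL-Analysis.Analysis"
begin

definition mittag_leffler :: "real \<Rightarrow> real \<Rightarrow> complex \<Rightarrow> complex" where
  "mittag_leffler \<alpha> \<beta> z = (\<Sum>n. z ^ n / of_real (Gamma (\<alpha> * real n + \<beta>)))"

text \<open>
  The functions \<open>P\<close> (meant for \<open>w > -1\<close>) and \<open>R\<close> (meant for \<open>v < \<alpha>\<close>) are used for
  positive \<open>t\<close> only, where \<open>powr\<close> is the usual real power.
\<close>

definition mittag_leffler_P :: "real \<Rightarrow> real \<Rightarrow> complex \<Rightarrow> real \<Rightarrow> complex" where
  "mittag_leffler_P \<alpha> w lam t =
     of_real (t powr w) * mittag_leffler \<alpha> (w + 1) (lam * of_real (t powr \<alpha>))"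

definition mittag_leffler_R :: "real \<Rightarrow> real \<Rightarrow> complex \<Rightarrow> real \<Rightarrow> complex" where
  "mittag_leffler_R \<alpha> v lam t =
     of_real (t powr (\<alpha> - v - 1)) * mittag_leffler \<alpha> (\<alpha> - v) (lam * of_real (t powr \<alpha>))"

text \<open>
  The interval integral over \<open>0..t\<close> with \<open>t > 0\<close> is the Lebesgue integral over the open
  interval, so possible endpoint singularities are never evaluated. It has the
  default value \<open>0\<close> if the integrand is not integrable; existence of the convolution at \<open>t\<close>
  is expressed by \<open>has_causal_convolution\<close>.
\<close>

definition causal_convolution ::
  "(real \<Rightarrow> complex) \<Rightarrow> (real \<Rightarrow> complex) \<Rightarrow> real \<Rightarrow> complex" where
  "causal_convolution f g t = (LBINT \<tau>=0..t. f (t - \<tau>) * g \<tau>)"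

definition has_causal_convolution ::
  "(real \<Rightarrow> complex) \<Rightarrow> (real \<Rightarrow> complex) \<Rightarrow> real \<Rightarrow> bool" where
  "has_causal_convolution f g t \<longleftrightarrow>
     interval_lebesgue_integrable lborel 0 t (\<lambda>\<tau>. f (t - \<tau>) * g \<tau>)"

end

theory Submission
  imports Defs
begin

text \<open>
  Both \<open>P\<close> and \<open>R\<close> are reparametrisations of
  \<open>t powr (\<mu> - 1) * E \<alpha> \<mu> (z * t powr \<alpha>)\<close> with \<open>\<mu> > 0\<close>, which is the power series in \<open>z\<close> whose
  coefficients are the Riemann--Liouville kernels \<open>t powr (a - 1) / \<Gamma>(a)\<close> at \<open>a = \<alpha> m + \<mu>\<close>.
  By the Beta integral these kernels form a convolution semigroup, so termwise convolution
  of the two series, first in one factor and then in the other, gives the claim.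
  The interchanges are dominated: since \<open>\<Gamma>(x)\<close> exceeds a constant times \<open>T powr x\<close> for every \<open>T\<close>,
  choosing \<open>T\<close> large bounds the double series by a product of geometric series.
  The second expansion is the first one after exchanging the factors.
\<close>

section \<open>Kernels underlying both \<open>P\<close> and \<open>R\<close>\<close>

definition rl_kernel :: "real \<Rightarrow> real \<Rightarrow> real" where
  "rl_kernel a t = t powr (a - 1) / Gamma a"

text \<open>The parameter is \<open>\<alpha> - v\<close> for \<open>R\<close> and
  \<open>w + 1\<close> for \<open>P\<close>, so both admissible ranges become
  \<open>\<mu> > 0\<close>.\<close>

definition ml_kernel :: "real \<Rightarrow> real \<Rightarrow> complex \<Rightarrow> real \<Rightarrow> complex" where
  "ml_kernel \<alpha> \<mu> z t = of_real (t powr (\<mu> - 1)) * mittag_leffler \<alpha> \<mu> (z * of_real (t powr \<alpha>))"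

lemma mittag_leffler_R_eq: "mittag_leffler_R \<alpha> v = ml_kernel \<alpha> (\<alpha> - v)"
  by (intro ext) (simp add: mittag_leffler_R_def ml_kernel_def)

lemma mittag_leffler_P_eq: "mittag_leffler_P \<alpha> w = ml_kernel \<alpha> (w + 1)"
  by (intro ext) (simp add: mittag_leffler_P_def ml_kernel_def)

lemma rl_kernel_nonneg: "a > 0 \<Longrightarrow> rl_kernel a t \<ge> 0"
  by (simp add: rl_kernel_def)

section \<open>Convolution at a point: existence, value, commutativity\<close>

text \<open>Integrability and value are asserted together, so the default value of a non-integrable
  integrand cannot interfere. The type is generic in order to serve real kernels and complex series
  alike.\<close>

definition has_convolution ::
  "(real \<Rightarrow> 'a::{real_normed_algebra, banach, second_countable_topology}) \<Rightarrow>
     (real \<Rightarrow> 'a) \<Rightarrow> real \<Rightarrow> 'a \<Rightarrow> bool" where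
  "has_convolution f g t c \<longleftrightarrow>
     has_bochner_integral lborel (\<lambda>x. indicator {0<..<t} x *\<^sub>R (f (t - x) * g x)) c"

lemma has_causal_convolution_iff:
  assumes "t > 0"
  shows "has_convolution f g t c \<longleftrightarrow>
           has_causal_convolution f g t \<and> causal_convolution f g t = c"
  using assms
  by (simp add: has_convolution_def has_causal_convolution_def causal_convolution_def
      has_bochner_integral_iff interval_lebesgue_integrable_def interval_lebesgue_integral_def
      set_integrable_def set_lebesgue_integral_def zero_ereal_def)

text \<open>The reflection \<open>x \<mapsto> t - x\<close> preserves Lebesgue measure and the
  interval \<open>{0<..<t}\<close>, and it exchanges the factors.\<close>

lemma has_convolution_commute:
  fixes f g :: "real \<Rightarrow> 'a::{real_normed_field, banach, second_countable_topology}"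
  assumes "has_convolution f g t c"
  shows "has_convolution g f t c"
proof -
  have "indicator {0<..<t} (t - x) = (indicator {0<..<t} x :: real)" for x
    by (auto simp: indicator_def)
  with assms show ?thesis
    using lborel_has_bochner_integral_real_affine_iff
      [of "-1" "\<lambda>x. indicator {0<..<t} x *\<^sub>R (f (t - x) * g x)" c t]
    by (simp add: has_convolution_def mult.commute)
qed

section \<open>Beta integral and the semigroup law\<close>

lemma has_bochner_integral_Beta:
  fixes a b :: real
  assumes "a > 0" "b > 0"
  shows "has_bochner_integral lborel
           (\<lambda>x. indicator {0<..<1} x *\<^sub>R (x powr (a - 1) * (1 - x) powr (b - 1))) (Beta a b)"
proof -
  have "has_bochner_integral lborel
           (\<lambda>x. indicator {0..1} x *\<^sub>R (x powr (a - 1) * (1 - x) powr (b - 1))) (Beta a b)"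
    using integrable_Beta[OF assms] has_integral_Beta_real[OF assms]
      set_borel_integral_eq_integral(2)[OF integrable_Beta[OF assms]]
    by (simp add: has_bochner_integral_iff set_integrable_def set_lebesgue_integral_def
        integral_unique)
  \<comment> \<open>At an endpoint one factor is a power of \<open>0\<close>, and
    \<open>0 powr _\<close> is \<open>0\<close> for every exponent, so the integrands agree at every
    point.\<close>
  moreover have "indicator {0..1} x *\<^sub>R (x powr (a - 1) * (1 - x) powr (b - 1)) =
                 indicator {0<..<1} x *\<^sub>R (x powr (a - 1) * (1 - x) powr (b - 1))" for x :: real
    by (cases "x = 0 \<or> x = 1") (auto simp: indicator_def)
  ultimately show ?thesis by (simp only:)
qed

text \<open>Scaling by \<open>t\<close> reduces the integral to \<open>Beta b a\<close>, whose Gamma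
  quotient cancels the normalising factors of the two kernels.\<close>

lemma rl_kernel_convolution:
  assumes "a > 0" "b > 0" "t > 0"
  shows "has_convolution (rl_kernel a) (rl_kernel b) t (rl_kernel (a + b) t)"
proof -
  let ?B = "\<lambda>x. indicator {0<..<1} x *\<^sub>R (x powr (b - 1) * (1 - x) powr (a - 1))"
  have "has_bochner_integral lborel (\<lambda>x. ?B (x / t)) (Beta b a * t)"
    using has_bochner_integral_Beta[of b a] assms
      lborel_has_bochner_integral_real_affine_iff[of "1 / t" ?B "Beta b a" 0]
    by (simp add: mult.commute)
  \<comment> \<open>The exponent \<open>a + b - 2\<close> collects the scaling of both kernels; the
    Jacobian \<open>t\<close> raises it to \<open>a + b - 1\<close>.\<close>
  then have "has_bochner_integral lborel
      (\<lambda>x. t powr (a + b - 2) / (Gamma a * Gamma b) * ?B (x / t))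
      (t powr (a + b - 2) / (Gamma a * Gamma b) * (Beta b a * t))"
    by (rule has_bochner_integral_mult_right)
  moreover have "t powr (a + b - 2) / (Gamma a * Gamma b) * (Beta b a * t) = rl_kernel (a + b) t"
  proof -
    have "t powr (a + b - 2) * t = t powr (a + b - 1)"
      using assms by (simp add: powr_mult_base mult.commute)
    then show ?thesis
      using assms Gamma_real_pos[of a] Gamma_real_pos[of b] Gamma_real_pos[of "a + b"]
      by (simp add: rl_kernel_def Beta_def field_simps del: Gamma_real_pos)
  qed
  moreover have "t powr (a + b - 2) / (Gamma a * Gamma b) * ?B (x / t) =
      indicator {0<..<t} x *\<^sub>R (rl_kernel a (t - x) * rl_kernel b x)" for x
  proof (cases "x \<in> {0<..<t}")
    case True
    then have "1 - x / t = (t - x) / t" "x / t \<in> {0<..<1}"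
      by (auto simp: field_simps)
    moreover have "t powr (a + b - 2) = t powr (a - 1) * t powr (b - 1)"
      by (simp flip: powr_add)
    ultimately show ?thesis
      using True assms by (simp add: rl_kernel_def powr_divide)
  next
    case False
    then have "x / t \<notin> {0<..<1}" using assms by (auto simp: field_simps)
    with False show ?thesis by simp
  qed
  ultimately show ?thesis by (simp add: has_convolution_def)
qed

section \<open>Growth of Gamma and absolute convergence\<close>

text \<open>Restricting the Gamma integral to \<open>[T, T + 1]\<close> shows that \<open>\<Gamma>\<close> beats every exponential,
  uniformly on the whole positive axis.\<close>

lemma Gamma_ge_exponential:
  fixes x T :: real
  assumes "x > 0" "T \<ge> 1"
  shows "T powr x / ((T + 1) * exp (T + 1)) \<le> Gamma x"
proof -
  have integrable: "(\<lambda>s. s powr (x - 1) / exp s) integrable_on {T..T + 1}"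
    using assms Gamma_integral_real[of x] by (auto intro: integrable_on_subinterval)
  have "((\<lambda>s. T powr x / ((T + 1) * exp (T + 1))) has_integral
          T powr x / ((T + 1) * exp (T + 1))) {T..T + 1}"
    using has_integral_const_real[of "T powr x / ((T + 1) * exp (T + 1))" T "T + 1"] by simp
  moreover have "T powr x / ((T + 1) * exp (T + 1)) \<le> s powr (x - 1) / exp s"
    if "s \<in> {T..T + 1}" for s
  proof -
    \<comment> \<open>As \<open>x - 1\<close> may be negative, \<open>1 / s\<close> is split off:
      \<open>s powr x\<close> increases in \<open>s\<close>, and \<open>s \<le> T + 1\<close> bounds
      both \<open>s\<close> and \<open>exp s\<close> in the denominator.\<close>
    have "s powr (x - 1) = s powr x / s"
      using that assms by (simp add: powr_diff)
    moreover have "T powr x / ((T + 1) * exp (T + 1)) \<le> s powr x / (s * exp s)"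
      using that assms by (intro frac_le mult_mono powr_mono2 mult_pos_pos) auto
    ultimately show ?thesis by simp
  qed
  ultimately have "T powr x / ((T + 1) * exp (T + 1)) \<le>
      integral {T..T + 1} (\<lambda>s. s powr (x - 1) / exp s)"
    by (intro has_integral_le[OF _ integrable_integral[OF integrable]]) auto
  also have "\<dots> \<le> integral {0..} (\<lambda>s. s powr (x - 1) / exp s)"
    using assms Gamma_integral_real[of x] integrable by (intro integral_subset_le) auto
  also have "\<dots> = Gamma x"
    using Gamma_integral_real[of x] assms by (simp add: integral_unique)
  finally show ?thesis .
qed

text \<open>The lower bound on \<open>Gamma\<close> turns into exponential decay in \<open>a\<close>
  once \<open>T > t\<close>, with a prefactor independent of \<open>a\<close>.\<close>

lemma rl_kernel_le:
  assumes "a > 0" "t > 0" "T \<ge> 1"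
  shows "rl_kernel a t \<le> (T + 1) * exp (T + 1) / t * (t / T) powr a"
proof -
  have "rl_kernel a t \<le> t powr (a - 1) / (T powr a / ((T + 1) * exp (T + 1)))"
    unfolding rl_kernel_def using assms
    by (intro divide_left_mono Gamma_ge_exponential mult_pos_pos divide_pos_pos) auto
  also have "\<dots> = (T + 1) * exp (T + 1) / t * (t / T) powr a"
    using assms by (simp add: powr_diff powr_divide field_simps)
  finally show ?thesis .
qed

text \<open>Phrased with \<open>eventually\<close> so that a single \<open>T\<close> can meet the
  requirement for two series together with \<open>T \<ge> 1\<close>.\<close>

lemma eventually_ratio_powr_le_half:
  fixes \<alpha> t :: real
  assumes "\<alpha> > 0" "t > 0"
  shows "eventually (\<lambda>T. r * (t / T) powr \<alpha> \<le> 1 / 2) at_top"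
proof -
  have "((\<lambda>T. r * (t / T) powr \<alpha>) \<longlongrightarrow> r * 0) at_top"
  proof (intro tendsto_intros)
    have "((\<lambda>T. t powr \<alpha> * T powr (- \<alpha>)) \<longlongrightarrow> t powr \<alpha> * 0) at_top"
      using assms by (intro tendsto_intros tendsto_neg_powr filterlim_ident) auto
    moreover have "eventually (\<lambda>T. t powr \<alpha> * T powr (- \<alpha>) = (t / T) powr \<alpha>) at_top"
      using assms
      by (intro eventually_mono[OF eventually_gt_at_top[of 0]])
         (simp add: powr_divide powr_minus field_simps)
    ultimately show "((\<lambda>T. (t / T) powr \<alpha>) \<longlongrightarrow> 0) at_top"
      by (simp add: tendsto_cong)
  qed
  from order_tendstoD(2)[OF this, of "1 / 2"] show ?thesis
    by (auto elim: eventually_mono)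
qed

lemma rl_kernel_series_term_le:
  assumes "\<alpha> > 0" "\<mu> > 0" "t > 0" "T \<ge> 1" "norm z * (t / T) powr \<alpha> \<le> 1 / 2"
  shows "norm (z ^ m * of_real (rl_kernel (\<alpha> * real m + \<mu>) t) :: complex) \<le>
           (T + 1) * exp (T + 1) / t * (t / T) powr \<mu> * (1 / 2) ^ m"
proof -
  have pos: "\<alpha> * real m + \<mu> > 0"
    using assms by (intro add_nonneg_pos) auto
  have "norm (z ^ m * of_real (rl_kernel (\<alpha> * real m + \<mu>) t)) =
      norm z ^ m * rl_kernel (\<alpha> * real m + \<mu>) t"
    using rl_kernel_nonneg[OF pos] by (simp add: norm_mult norm_power)
  also have "\<dots> \<le> norm z ^ m * ((T + 1) * exp (T + 1) / t * (t / T) powr (\<alpha> * real m + \<mu>))"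
    using assms pos by (intro mult_left_mono rl_kernel_le) auto
  also have "\<dots> = (T + 1) * exp (T + 1) / t * (t / T) powr \<mu> * (norm z * (t / T) powr \<alpha>) ^ m"
    using assms by (simp add: powr_add powr_powr[symmetric] powr_realpow power_mult_distrib)
  also have "\<dots> \<le> (T + 1) * exp (T + 1) / t * (t / T) powr \<mu> * (1 / 2) ^ m"
    using assms by (intro mult_left_mono power_mono) auto
  finally show ?thesis .
qed

lemma
  assumes "\<alpha> > 0" "\<mu> > 0" "t > 0"
  shows summable_norm_ml_kernel:
      "summable (\<lambda>m. norm (z ^ m * of_real (rl_kernel (\<alpha> * real m + \<mu>) t) :: complex))"
    and ml_kernel_sums: "(\<lambda>m. z ^ m * of_real (rl_kernel (\<alpha> * real m + \<mu>) t)) sums ml_kernel \<alpha> \<mu> z t"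
proof -
  obtain T where T: "T \<ge> 1" "norm z * (t / T) powr \<alpha> \<le> 1 / 2"
    using eventually_happens[OF eventually_conj[OF eventually_ge_at_top[of 1]
      eventually_ratio_powr_le_half[OF assms(1,3), of "norm z"]]] by auto
  show *: "summable (\<lambda>m. norm (z ^ m * of_real (rl_kernel (\<alpha> * real m + \<mu>) t) :: complex))"
    by (rule summable_comparison_test'[where N = 0,
          where g = "\<lambda>m. (T + 1) * exp (T + 1) / t * (t / T) powr \<mu> * (1 / 2) ^ m"])
       (use rl_kernel_series_term_le[OF assms T] in \<open>auto intro!: summable_mult summable_geometric\<close>)
  have eq: "z ^ m * of_real (rl_kernel (\<alpha> * real m + \<mu>) t) =
      of_real (t powr (\<mu> - 1)) *
        ((z * of_real (t powr \<alpha>)) ^ m / of_real (Gamma (\<alpha> * real m + \<mu>)))" for m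
  proof -
    have "t powr (\<alpha> * real m + \<mu> - 1) = t powr (\<mu> - 1) * (t powr \<alpha>) ^ m"
      using assms
      by (simp add: powr_realpow[symmetric] powr_powr powr_add[symmetric] algebra_simps)
    then show ?thesis by (simp add: rl_kernel_def power_mult_distrib)
  qed
  \<comment> \<open>\<open>mittag_leffler\<close> is a bare \<open>suminf\<close>, so convergence of
    its own series has to be secured first, by cancelling the nonzero factor
    \<open>t powr (\<mu> - 1)\<close>.\<close>
  have "summable (\<lambda>m. of_real (t powr (\<mu> - 1)) *
        ((z * of_real (t powr \<alpha>)) ^ m / of_real (Gamma (\<alpha> * real m + \<mu>))))"
    using summable_norm_cancel[OF *] unfolding eq .
  then have "summable (\<lambda>m. (z * of_real (t powr \<alpha>)) ^ m / of_real (Gamma (\<alpha> * real m + \<mu>)))"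
    using assms by (subst (asm) summable_cmult_iff) auto
  then show "(\<lambda>m. z ^ m * of_real (rl_kernel (\<alpha> * real m + \<mu>) t)) sums ml_kernel \<alpha> \<mu> z t"
    unfolding eq ml_kernel_def mittag_leffler_def by (intro sums_mult summable_sums)
qed

text \<open>Summing the geometric bounds gives the factor \<open>2\<close>. The condition on
  \<open>T\<close> does not involve \<open>\<mu>\<close>, so one \<open>T\<close> later serves all
  shifted parameters at once.\<close>

lemma norm_ml_kernel_le:
  assumes "\<alpha> > 0" "\<mu> > 0" "t > 0" "T \<ge> 1" "norm z * (t / T) powr \<alpha> \<le> 1 / 2"
  shows "norm (ml_kernel \<alpha> \<mu> z t) \<le> 2 * ((T + 1) * exp (T + 1) / t) * (t / T) powr \<mu>"
proof -
  have "(\<lambda>m. (T + 1) * exp (T + 1) / t * (t / T) powr \<mu> * (1 / 2) ^ m) sums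
      ((T + 1) * exp (T + 1) / t * (t / T) powr \<mu> * 2)"
    using sums_mult[OF geometric_sums[of "1 / 2 :: real"],
        of "(T + 1) * exp (T + 1) / t * (t / T) powr \<mu>"] by simp
  then show ?thesis
    using norm_sums_le[OF ml_kernel_sums[OF assms(1-3)] _ rl_kernel_series_term_le[OF assms]]
    by (simp add: mult_ac)
qed

text \<open>The coefficients are nonnegative, so the triangle inequality leads to the same series at
  \<open>norm z\<close>; its value is real and \<open>Re\<close> merely casts it.\<close>

lemma norm_ml_kernel_le_abs:
  assumes "\<alpha> > 0" "\<mu> > 0" "t > 0"
  shows "norm (ml_kernel \<alpha> \<mu> z t) \<le> Re (ml_kernel \<alpha> \<mu> (of_real (norm z)) t)"
proof (rule norm_sums_le[OF ml_kernel_sums[OF assms]])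
  show "(\<lambda>m. Re (of_real (norm z) ^ m * of_real (rl_kernel (\<alpha> * real m + \<mu>) t))) sums
      Re (ml_kernel \<alpha> \<mu> (of_real (norm z)) t)"
    by (intro sums_Re ml_kernel_sums assms)
  show "norm (z ^ m * of_real (rl_kernel (\<alpha> * real m + \<mu>) t)) \<le>
      Re (of_real (norm z) ^ m * of_real (rl_kernel (\<alpha> * real m + \<mu>) t))" for m
  proof -
    have "rl_kernel (\<alpha> * real m + \<mu>) t \<ge> 0"
      using assms by (intro rl_kernel_nonneg add_nonneg_pos) auto
    then show ?thesis
      by (simp add: norm_mult norm_power flip: of_real_power of_real_mult)
  qed
qed

section \<open>Termwise integration and convolution of the series\<close>

text \<open>Summable L1 norms permit exchanging sum and integral. Only a common value
  \<open>I\<close> is claimed; uniqueness of sums identifies it where a closed form is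
  known.\<close>

lemma has_bochner_integral_sums:
  fixes f :: "nat \<Rightarrow> 'a \<Rightarrow> 'b::{banach, second_countable_topology}"
  assumes int: "\<And>i. has_bochner_integral M (f i) (c i)"
    and bound: "\<And>i. (\<integral>x. norm (f i x) \<partial>M) \<le> b i" and b: "summable b"
    and summ: "\<And>x. summable (\<lambda>i. norm (f i x))"
    and sums: "\<And>x. (\<lambda>i. f i x) sums F x"
  shows "\<exists>I. has_bochner_integral M F I \<and> c sums I"
proof -
  have F: "F = (\<lambda>x. \<Sum>i. f i x)" using sums by (auto simp: sums_iff)
  have c: "integrable M (f i)" "integral\<^sup>L M (f i) = c i" for i
    using int[of i] by (auto simp: has_bochner_integral_iff)
  have s: "summable (\<lambda>i. \<integral>x. norm (f i x) \<partial>M)"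
    by (rule summable_comparison_test'[OF b, of 0]) (use bound in auto)
  show ?thesis
    using integrable_suminf[of M f, OF c(1) _ s] sums_integral[of M f, OF c(1) _ s] summ c(2)
    unfolding F by (auto simp: has_bochner_integral_iff)
qed

text \<open>Convolution with \<open>rl_kernel b\<close> is fractional integration of order
  \<open>b\<close>: by the semigroup law it raises the order of every kernel in the series by
  \<open>b\<close>.\<close>

lemma ml_kernel_convolution_rl_kernel:
  assumes "\<alpha> > 0" "\<mu> > 0" "b > 0" "t > 0"
  shows "has_convolution (ml_kernel \<alpha> \<mu> z) (\<lambda>x. of_real (rl_kernel b x)) t
           (ml_kernel \<alpha> (\<mu> + b) z t)"
proof -
  have pos: "\<alpha> * real m + \<mu> > 0" for m
    using assms by (intro add_nonneg_pos) auto
  define g :: "nat \<Rightarrow> real \<Rightarrow> real" where "g m x = indicator {0<..<t} x *\<^sub>R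
      (rl_kernel (\<alpha> * real m + \<mu>) (t - x) * rl_kernel b x)" for m x
  have g: "has_bochner_integral lborel (g m) (rl_kernel (\<alpha> * real m + (\<mu> + b)) t)" for m
    using rl_kernel_convolution[OF pos assms(3,4)]
    by (simp add: g_def[abs_def] has_convolution_def add.assoc)
  have g_nonneg: "g m x \<ge> 0" for m x
    unfolding g_def using pos assms(3) by (simp add: rl_kernel_nonneg)
  have "\<exists>I. has_bochner_integral lborel
      (\<lambda>x. indicator {0<..<t} x *\<^sub>R (ml_kernel \<alpha> \<mu> z (t - x) * of_real (rl_kernel b x))) I \<and>
      (\<lambda>m. z ^ m * of_real (rl_kernel (\<alpha> * real m + (\<mu> + b)) t)) sums I"
  proof (rule has_bochner_integral_sums)
    show "has_bochner_integral lborel (\<lambda>x. z ^ m * of_real (g m x))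
        (z ^ m * of_real (rl_kernel (\<alpha> * real m + (\<mu> + b)) t))" for m
      by (intro has_bochner_integral_mult_right has_bochner_integral_of_real g)
    \<comment> \<open>Since \<open>g\<close> is nonnegative, the L1 norm equals the modulus of the
      integral, and the summability required is absolute convergence of the target series.\<close>
    show "(\<integral>x. norm (z ^ m * of_real (g m x)) \<partial>lborel) \<le>
        norm (z ^ m * of_real (rl_kernel (\<alpha> * real m + (\<mu> + b)) t))" for m
    proof -
      have "(\<integral>x. norm (z ^ m * of_real (g m x)) \<partial>lborel) =
          norm z ^ m * rl_kernel (\<alpha> * real m + (\<mu> + b)) t"
        using has_bochner_integral_integral_eq[OF g] g_nonneg
        by (simp add: norm_mult norm_power)
      also have "\<dots> = norm (z ^ m * of_real (rl_kernel (\<alpha> * real m + (\<mu> + b)) t))"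
        using rl_kernel_nonneg[of "\<alpha> * real m + \<mu> + b" t] pos[of m] assms(3)
        by (simp add: norm_mult norm_power add.assoc)
      finally show ?thesis by (rule eq_refl)
    qed
    show "summable (\<lambda>m. norm (z ^ m * of_real (rl_kernel (\<alpha> * real m + (\<mu> + b)) t)))"
      using assms by (intro summable_norm_ml_kernel) auto
    show "summable (\<lambda>m. norm (z ^ m * complex_of_real (g m x)))" for x
    proof (cases "x \<in> {0<..<t}")
      case True
      then show ?thesis
        using summable_mult2[OF summable_norm_ml_kernel[of \<alpha> \<mu> "t - x" z],
            of "norm (rl_kernel b x)"] assms
        by (simp add: g_def norm_mult abs_mult mult.assoc)
    qed (simp add: g_def)
    show "(\<lambda>m. z ^ m * complex_of_real (g m x)) sums
        (indicator {0<..<t} x *\<^sub>R (ml_kernel \<alpha> \<mu> z (t - x) * of_real (rl_kernel b x)))" for x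
    proof (cases "x \<in> {0<..<t}")
      case True
      then show ?thesis
        using sums_mult2[OF ml_kernel_sums[of \<alpha> \<mu> "t - x" z], of "of_real (rl_kernel b x)"] assms
        by (simp add: g_def mult.assoc)
    qed (simp add: g_def)
  qed
  moreover have "(\<lambda>m. z ^ m * of_real (rl_kernel (\<alpha> * real m + (\<mu> + b)) t)) sums
      ml_kernel \<alpha> (\<mu> + b) z t"
    using assms by (intro ml_kernel_sums) auto
  ultimately show ?thesis
    unfolding has_convolution_def by (metis sums_unique2)
qed

text \<open>The second factor is expanded into kernels of order
  \<open>\<beta> * real k + \<nu>\<close>, each of which shifts the parameter of the first factor by
  its order.\<close>

lemma ml_kernel_convolution_sums:
  assumes "\<alpha> > 0" "\<beta> > 0" "\<mu> > 0" "\<nu> > 0" "t > 0"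
  shows "\<exists>I. has_convolution (ml_kernel \<alpha> \<mu> z) (ml_kernel \<beta> \<nu> w) t I \<and>
           (\<lambda>k. w ^ k * ml_kernel \<alpha> (\<mu> + \<nu> + \<beta> * real k) z t) sums I"
  unfolding has_convolution_def
proof -
  \<comment> \<open>The condition for \<open>z\<close> is stated at \<open>of_real (norm z)\<close>,
    the argument at which \<open>norm_ml_kernel_le\<close> is applied.\<close>
  obtain T where T: "T \<ge> 1" "norm (of_real (norm z) :: complex) * (t / T) powr \<alpha> \<le> 1 / 2"
      "norm w * (t / T) powr \<beta> \<le> 1 / 2"
    using eventually_happens[OF eventually_conj[OF eventually_ge_at_top[of 1] eventually_conj[OF
      eventually_ratio_powr_le_half[OF assms(1,5), of "norm z"]
      eventually_ratio_powr_le_half[OF assms(2,5), of "norm w"]]]] by auto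
  have pos: "\<beta> * real k + \<nu> > 0" for k
    using assms by (intro add_nonneg_pos) auto
  \<comment> \<open>\<open>u = z\<close> gives the actual terms, \<open>u = of_real (norm z)\<close>
    their majorants. The actual terms may oscillate, so their L1 norms are bounded through the
    explicit integrals of the majorants.\<close>
  define h :: "complex \<Rightarrow> nat \<Rightarrow> real \<Rightarrow> complex" where "h u k x = indicator {0<..<t} x *\<^sub>R
      (ml_kernel \<alpha> \<mu> u (t - x) * of_real (rl_kernel (\<beta> * real k + \<nu>) x))" for u k x
  have h: "has_bochner_integral lborel (h u k) (ml_kernel \<alpha> (\<mu> + \<nu> + \<beta> * real k) u t)" for u k
    using ml_kernel_convolution_rl_kernel[OF assms(1,3) pos assms(5)]
    by (simp add: h_def[abs_def] has_convolution_def add_ac)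
  have norm_h: "norm (h z k x) \<le> Re (h (of_real (norm z)) k x)" for k x
    using rl_kernel_nonneg[OF pos, of k x] norm_ml_kernel_le_abs[of \<alpha> \<mu> "t - x" z] assms
    by (auto simp: h_def norm_mult indicator_def intro!: mult_right_mono)
  \<comment> \<open>\<open>C\<close> gathers what is independent of \<open>k\<close>; the remaining
    \<open>((t / T) powr \<beta>) ^ k\<close> joins \<open>norm w ^ k\<close> to give a ratio of at
    most \<open>1 / 2\<close>.\<close>
  define C where "C = 2 * ((T + 1) * exp (T + 1) / t) * (t / T) powr (\<mu> + \<nu>)"
  show "\<exists>I. has_bochner_integral lborel
      (\<lambda>x. indicator {0<..<t} x *\<^sub>R (ml_kernel \<alpha> \<mu> z (t - x) * ml_kernel \<beta> \<nu> w x)) I \<and>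
      (\<lambda>k. w ^ k * ml_kernel \<alpha> (\<mu> + \<nu> + \<beta> * real k) z t) sums I"
  proof (rule has_bochner_integral_sums)
    show "has_bochner_integral lborel (\<lambda>x. w ^ k * h z k x)
        (w ^ k * ml_kernel \<alpha> (\<mu> + \<nu> + \<beta> * real k) z t)" for k
      by (intro has_bochner_integral_mult_right h)
    show "(\<integral>x. norm (w ^ k * h z k x) \<partial>lborel) \<le> C * (1 / 2) ^ k" for k
    proof -
      have "has_bochner_integral lborel (\<lambda>x. Re (h (of_real (norm z)) k x))
          (Re (ml_kernel \<alpha> (\<mu> + \<nu> + \<beta> * real k) (of_real (norm z)) t))"
        using h by (rule has_bochner_integral_Re)
      then have "(\<integral>x. norm (h z k x) \<partial>lborel) \<le>
          Re (ml_kernel \<alpha> (\<mu> + \<nu> + \<beta> * real k) (of_real (norm z)) t)"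
        using h[of z k] norm_h
          integral_mono[of lborel "\<lambda>x. norm (h z k x)" "\<lambda>x. Re (h (of_real (norm z)) k x)"]
        by (auto simp: has_bochner_integral_iff)
      also have "\<dots> \<le> norm (ml_kernel \<alpha> (\<mu> + \<nu> + \<beta> * real k) (of_real (norm z)) t)"
        by (rule complex_Re_le_cmod)
      also have "\<dots> \<le> 2 * ((T + 1) * exp (T + 1) / t) * (t / T) powr (\<mu> + \<nu> + \<beta> * real k)"
        using assms T by (intro norm_ml_kernel_le add_pos_nonneg) auto
      also have "\<dots> = C * ((t / T) powr \<beta>) ^ k"
        using assms T by (simp add: C_def powr_add powr_powr[symmetric] powr_realpow)
      finally have "norm w ^ k * (\<integral>x. norm (h z k x) \<partial>lborel) \<le>
          norm w ^ k * (C * ((t / T) powr \<beta>) ^ k)"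
        by (intro mult_left_mono) auto
      also have "\<dots> = C * (norm w * (t / T) powr \<beta>) ^ k"
        by (simp add: power_mult_distrib)
      also have "\<dots> \<le> C * (1 / 2) ^ k"
        using T assms by (intro mult_left_mono power_mono) (auto simp: C_def)
      finally show ?thesis by (simp add: norm_mult norm_power)
    qed
    show "summable (\<lambda>k. C * (1 / 2) ^ k)"
      by (intro summable_mult summable_geometric) auto
    show "summable (\<lambda>k. norm (w ^ k * h z k x))" for x
    proof (cases "x \<in> {0<..<t}")
      case True
      then show ?thesis
        using summable_mult2[OF summable_norm_ml_kernel[of \<beta> \<nu> x w],
            of "norm (ml_kernel \<alpha> \<mu> z (t - x))"] assms
        by (simp add: h_def norm_mult mult_ac)
    qed (simp add: h_def)
    show "(\<lambda>k. w ^ k * h z k x) sums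
        (indicator {0<..<t} x *\<^sub>R (ml_kernel \<alpha> \<mu> z (t - x) * ml_kernel \<beta> \<nu> w x))" for x
    proof (cases "x \<in> {0<..<t}")
      case True
      then show ?thesis
        using sums_mult[OF ml_kernel_sums[of \<beta> \<nu> x w], of "ml_kernel \<alpha> \<mu> z (t - x)"] assms
        by (simp add: h_def mult_ac)
    qed (simp add: h_def)
  qed
qed

text \<open>Expanding with the factors in either order gives two series; commutativity and
  uniqueness of the integral force the same sum.\<close>

lemma ml_kernel_causal_convolution:
  fixes z w :: complex
  assumes "\<alpha> > 0" "\<beta> > 0" "\<mu> > 0" "\<nu> > 0" "t > 0"
  defines "c \<equiv> causal_convolution (ml_kernel \<alpha> \<mu> z) (ml_kernel \<beta> \<nu> w) t"
  shows "has_causal_convolution (ml_kernel \<alpha> \<mu> z) (ml_kernel \<beta> \<nu> w) t"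
    and "(\<lambda>k. w ^ k * ml_kernel \<alpha> (\<mu> + \<nu> + \<beta> * real k) z t) sums c"
    and "(\<lambda>j. z ^ j * ml_kernel \<beta> (\<mu> + \<nu> + \<alpha> * real j) w t) sums c"
proof -
  obtain I where I: "has_convolution (ml_kernel \<alpha> \<mu> z) (ml_kernel \<beta> \<nu> w) t I"
      "(\<lambda>k. w ^ k * ml_kernel \<alpha> (\<mu> + \<nu> + \<beta> * real k) z t) sums I"
    using ml_kernel_convolution_sums[OF assms(1-5)] by blast
  obtain J where J: "has_convolution (ml_kernel \<beta> \<nu> w) (ml_kernel \<alpha> \<mu> z) t J"
      "(\<lambda>j. z ^ j * ml_kernel \<beta> (\<nu> + \<mu> + \<alpha> * real j) w t) sums J"
    using ml_kernel_convolution_sums[OF assms(2,1,4,3,5)] by blast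
  have "has_causal_convolution (ml_kernel \<alpha> \<mu> z) (ml_kernel \<beta> \<nu> w) t" "c = I" "c = J"
    using I(1) has_convolution_commute[OF J(1)] has_causal_convolution_iff[OF assms(5)]
    by (auto simp: c_def)
  with I(2) J(2) show "has_causal_convolution (ml_kernel \<alpha> \<mu> z) (ml_kernel \<beta> \<nu> w) t"
    "(\<lambda>k. w ^ k * ml_kernel \<alpha> (\<mu> + \<nu> + \<beta> * real k) z t) sums c"
    "(\<lambda>j. z ^ j * ml_kernel \<beta> (\<mu> + \<nu> + \<alpha> * real j) w t) sums c"
    by (simp_all add: add.commute)
qed

section \<open>Translation back to \<open>R\<close> and \<open>P\<close>\<close>

theorem theorem3p1:
  fixes \<alpha> \<beta> t :: real and lam \<sigma> :: complex
  assumes "\<alpha> > 0" and "\<beta> > 0" and "t > 0"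
  shows
    "(\<forall>v1 v2 v. v1 < \<alpha> \<and> v2 < \<beta> \<and> v = v1 + v2 \<longrightarrow>
        has_causal_convolution (mittag_leffler_R \<alpha> v1 lam) (mittag_leffler_R \<beta> v2 \<sigma>) t \<and>
        (\<lambda>k. \<sigma> ^ k * mittag_leffler_R \<alpha> (v - \<beta> * (real k + 1)) lam t) sums
          causal_convolution (mittag_leffler_R \<alpha> v1 lam) (mittag_leffler_R \<beta> v2 \<sigma>) t \<and>
        (\<lambda>j. lam ^ j * mittag_leffler_R \<beta> (v - \<alpha> * (real j + 1)) \<sigma> t) sums
          causal_convolution (mittag_leffler_R \<alpha> v1 lam) (mittag_leffler_R \<beta> v2 \<sigma>) t) \<and>
     (\<forall>w1 w2 w. w1 > -1 \<and> w2 > -1 \<and> w = w1 + w2 \<longrightarrow>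
        has_causal_convolution (mittag_leffler_P \<alpha> w1 lam) (mittag_leffler_P \<beta> w2 \<sigma>) t \<and>
        (\<lambda>k. \<sigma> ^ k * mittag_leffler_P \<alpha> (w + \<beta> * real k + 1) lam t) sums
          causal_convolution (mittag_leffler_P \<alpha> w1 lam) (mittag_leffler_P \<beta> w2 \<sigma>) t \<and>
        (\<lambda>j. lam ^ j * mittag_leffler_P \<beta> (w + \<alpha> * real j + 1) \<sigma> t) sums
          causal_convolution (mittag_leffler_P \<alpha> w1 lam) (mittag_leffler_P \<beta> w2 \<sigma>) t)"
proof (intro conjI allI impI)
  fix v1 v2 v assume v: "v1 < \<alpha> \<and> v2 < \<beta> \<and> v = v1 + v2"
  then have "\<alpha> - v1 > 0" "\<beta> - v2 > 0" by auto
  note * = ml_kernel_causal_convolution[OF assms(1,2) this assms(3)]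
  \<comment> \<open>The \<open>+ 1\<close> in \<open>real k + 1\<close> supplies the
    \<open>\<beta>\<close> (or \<open>\<alpha>\<close>) by which the sum of the two kernel
    parameters exceeds \<open>\<alpha> - v\<close> (or \<open>\<beta> - v\<close>).\<close>
  have R: "mittag_leffler_R \<alpha> (v - \<beta> * (real k + 1)) = ml_kernel \<alpha> (\<alpha> - v1 + (\<beta> - v2) + \<beta> * real k)"
    "mittag_leffler_R \<beta> (v - \<alpha> * (real k + 1)) = ml_kernel \<beta> (\<alpha> - v1 + (\<beta> - v2) + \<alpha> * real k)" for k
    using v by (simp_all add: mittag_leffler_R_eq algebra_simps)
  show "has_causal_convolution (mittag_leffler_R \<alpha> v1 lam) (mittag_leffler_R \<beta> v2 \<sigma>) t"
    "(\<lambda>k. \<sigma> ^ k * mittag_leffler_R \<alpha> (v - \<beta> * (real k + 1)) lam t) sums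
          causal_convolution (mittag_leffler_R \<alpha> v1 lam) (mittag_leffler_R \<beta> v2 \<sigma>) t"
    "(\<lambda>j. lam ^ j * mittag_leffler_R \<beta> (v - \<alpha> * (real j + 1)) \<sigma> t) sums
          causal_convolution (mittag_leffler_R \<alpha> v1 lam) (mittag_leffler_R \<beta> v2 \<sigma>) t"
    unfolding R unfolding mittag_leffler_R_eq by (rule *)+
next
  fix w1 w2 w :: real assume w: "w1 > -1 \<and> w2 > -1 \<and> w = w1 + w2"
  then have "w1 + 1 > 0" "w2 + 1 > 0" by auto
  note * = ml_kernel_causal_convolution[OF assms(1,2) this assms(3)]
  \<comment> \<open>Of the two units in the parameter, one is the explicit \<open>+ 1\<close> in the
    index and one comes from passing from \<open>P\<close> to \<open>ml_kernel\<close>.\<close>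
  have P: "mittag_leffler_P \<alpha> (w + \<beta> * real k + 1) = ml_kernel \<alpha> (w1 + 1 + (w2 + 1) + \<beta> * real k)"
    "mittag_leffler_P \<beta> (w + \<alpha> * real k + 1) = ml_kernel \<beta> (w1 + 1 + (w2 + 1) + \<alpha> * real k)" for k
    using w by (simp_all add: mittag_leffler_P_eq algebra_simps)
  show "has_causal_convolution (mittag_leffler_P \<alpha> w1 lam) (mittag_leffler_P \<beta> w2 \<sigma>) t"
    "(\<lambda>k. \<sigma> ^ k * mittag_leffler_P \<alpha> (w + \<beta> * real k + 1) lam t) sums
          causal_convolution (mittag_leffler_P \<alpha> w1 lam) (mittag_leffler_P \<beta> w2 \<sigma>) t"
    "(\<lambda>j. lam ^ j * mittag_leffler_P \<beta> (w + \<alpha> * real j + 1) \<sigma> t) sums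
          causal_convolution (mittag_leffler_P \<alpha> w1 lam) (mittag_leffler_P \<beta> w2 \<sigma>) t"
    unfolding P unfolding mittag_leffler_P_eq by (rule *)+
qed

end
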